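(* Let $f:[0,1]\to\mathbb{R}$, let $N\ge 1$ and $K\ge 2$ be integers, and let $T$ be the quantized tensor representation of $f$ on $\mathcal{D}_K$. Define tensor cores, for $\alpha,\beta\in\{0,\dots,N\}$ and $\sigma\in\{0,1\}$, by $$A_L^{1,\beta}(\sigma)=f\left(\frac{\sigma+c^\beta}{2}\right),\qquad A^{\alpha\beta}(\sigma)=P^\alpha\left(\frac{\sigma+c^\beta}{2}\right),\qquad A_R^{\alpha,1}(\sigma)=P^\alpha\left(\frac{\sigma}{2}\right).$$ Then the matrix product state $S:=A_LA^{K-2}A_R$ satisfies $$\|S-T\|_\infty\le E_{1,N}[f].$$ In particular, if $f$ is a polynomial of degree at most $N$, then $S=T$.
   Context: Chebyshev-Lobatto grid on $[0,1]$ (with $N$ fixed and suppressed): $c^\alpha=c_N^\alpha=\frac{\cos(\pi\alpha/N)+1}{2}$, $\alpha=0,\dots,N$; $P^\alpha=P_N^\alpha$ is the Lagrange basis polynomial of degree $N$ with $P^\alpha(c^\beta)=\delta^{\alpha\beta}$. The matrix product state $A_LA^{K-2}A_R$ is the tensor $S:\{0,1\}^K\to\mathbb{R}$ given by the matrix product $S(\sigma_1,\dots,\sigma_K)=A_L(\sigma_1)A(\sigma_2)\cdots A(\sigma_{K-1})A_R(\sigma_K)$, where $A_L(\sigma)$ is $1\times(N+1)$, $A(\sigma)$ is $(N+1)\times(N+1)$ and $A_R(\sigma)$ is $(N+1)\times 1$. Dyadic grid: $\mathcal{D}_K=(2^{-K}\mathbb{Z})\cap[0,1)$; each $x\in\mathcal{D}_K$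 is written uniquely as $x=\sum_{k=1}^K 2^{-k}\sigma_k$ with $\sigma_k\in\{0,1\}$. The quantized tensor representation of $f$ on $\mathcal{D}_K$ is $T:\{0,1\}^K\to\mathbb{R}$, $T(\sigma_1,\dots,\sigma_K)=f\left(\sum_{k=1}^K 2^{-k}\sigma_k\right)$. Tensor norm: $\|S\|_\infty=\max_{\sigma\in\{0,1\}^K}|S(\sigma)|$. Interpolation error: $E_{m,N}[f]=\max_{u\in[0,1-2^{-m}],\,v\in[0,1]}\left|f(u+2^{-m}v)-\sum_{\alpha=0}^N f(u+2^{-m}c_N^\alpha)P_N^\alpha(v)\right|$ (maximum understood as a supremum, possibly $+\infty$, if not attained); here $m=1$. *)

theory Defs
  imports
    Complex_Main
    "HOL-Library.FuncSet"
    "HOL-Library.Extended_Real"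
    "HOL-Computational_Algebra.Polynomial"
    "Jordan_Normal_Form.Matrix"
begin

definition cheb_node :: "nat \<Rightarrow> nat \<Rightarrow> real" where
  "cheb_node N \<alpha> = (cos (pi * real \<alpha> / real N) + 1) / 2"

definition lagrange_basis :: "nat \<Rightarrow> nat \<Rightarrow> real poly" where
  "lagrange_basis N \<alpha> =
     (\<Prod>\<beta>\<in>{0..N} - {\<alpha>}. Polynomial.smult (1 / (cheb_node N \<alpha> - cheb_node N \<beta>)) [:- cheb_node N \<beta>, 1:])"

lemma cheb_node_inj:
  assumes "N \<ge> 1" "\<alpha> \<le> N" "\<beta> \<le> N" "cheb_node N \<alpha> = cheb_node N \<beta>"
  shows "\<alpha> = \<beta>"
proof -
  have bound: "0 \<le> pi * real k / real N \<and> pi * real k / real N \<le> pi" if "k \<le> N" for k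
    using that assms(1) by (simp add: divide_le_eq)
  have "cos (pi * real \<alpha> / real N) = cos (pi * real \<beta> / real N)"
    using assms(4) by (simp add: cheb_node_def)
  then have "pi * real \<alpha> / real N = pi * real \<beta> / real N"
    using bound[OF assms(2)] bound[OF assms(3)] cos_inj_pi by blast
  then show ?thesis using assms(1) by simp
qed

lemma poly_lagrange_basis_node:
  assumes "N \<ge> 1" "\<alpha> \<le> N" "\<beta> \<le> N"
  shows "poly (lagrange_basis N \<alpha>) (cheb_node N \<beta>) = (if \<alpha> = \<beta> then 1 else 0)"
proof (cases "\<alpha> = \<beta>")
  case True
  have "poly (lagrange_basis N \<alpha>) (cheb_node N \<alpha>) = 1"
    unfolding lagrange_basis_def poly_prod
  proof (intro prod.neutral ballI)
    fix \<gamma> assume "\<gamma> \<in> {0..N} - {\<alpha>}"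
    then have "cheb_node N \<alpha> - cheb_node N \<gamma> \<noteq> 0"
      using assms cheb_node_inj[of N \<alpha> \<gamma>] by auto
    then show "poly (Polynomial.smult (1 / (cheb_node N \<alpha> - cheb_node N \<gamma>))
        [:- cheb_node N \<gamma>, 1:]) (cheb_node N \<alpha>) = 1"
      by (simp add: divide_simps)
  qed
  with True show ?thesis by simp
next
  case False
  then show ?thesis
    using assms by (auto simp: lagrange_basis_def poly_prod intro!: prod_zero bexI[of _ \<beta>])
qed

lemma degree_lagrange_basis:
  assumes "N \<ge> 1" "\<alpha> \<le> N"
  shows "degree (lagrange_basis N \<alpha>) = N"
proof -
  have ne: "cheb_node N \<alpha> \<noteq> cheb_node N \<beta>" if "\<beta> \<in> {0..N} - {\<alpha>}" for \<beta>
    using that assms cheb_node_inj[of N \<alpha> \<beta>] by auto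
  have "degree (lagrange_basis N \<alpha>) = (\<Sum>\<beta>\<in>{0..N} - {\<alpha>}. 1)"
    unfolding lagrange_basis_def using ne by (subst degree_prod_eq_sum_degree) auto
  then show ?thesis using assms by simp
qed

text \<open>A tensor is a function on index tuples; only its values on \<open>bit_tuples K\<close> matter.
  Tuples are indexed from 1.\<close>

definition bit_tuples :: "nat \<Rightarrow> (nat \<Rightarrow> nat) set" where
  "bit_tuples K = ({1..K} \<rightarrow>\<^sub>E {0, 1})"

definition tensor_norm :: "nat \<Rightarrow> ((nat \<Rightarrow> nat) \<Rightarrow> real) \<Rightarrow> real" where
  "tensor_norm K S = Max ((\<lambda>\<sigma>. \<bar>S \<sigma>\<bar>) ` bit_tuples K)"

definition quantized_tensor :: "(real \<Rightarrow> real) \<Rightarrow> nat \<Rightarrow> (nat \<Rightarrow> nat) \<Rightarrow> real" where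
  "quantized_tensor f K \<sigma> = f (\<Sum>k=1..K. (1 / 2) ^ k * real (\<sigma> k))"

text \<open>The product of cores is bracketed to the right; the result is a 1-by-1 matrix, identified
  with its entry.\<close>

definition matrix_product_state ::
  "nat \<Rightarrow> (nat \<Rightarrow> real mat) \<Rightarrow> (nat \<Rightarrow> real mat) \<Rightarrow> (nat \<Rightarrow> real mat) \<Rightarrow> (nat \<Rightarrow> nat) \<Rightarrow> real" where
  "matrix_product_state K A\<^sub>L A A\<^sub>R \<sigma> =
     (A\<^sub>L (\<sigma> 1) * foldr (\<lambda>k M. A (\<sigma> k) * M) [2..<K] (A\<^sub>R (\<sigma> K))) $$ (0, 0)"

definition left_core :: "(real \<Rightarrow> real) \<Rightarrow> nat \<Rightarrow> nat \<Rightarrow> real mat" where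
  "left_core f N s = mat 1 (N + 1) (\<lambda>(_, \<beta>). f ((real s + cheb_node N \<beta>) / 2))"

definition mid_core :: "nat \<Rightarrow> nat \<Rightarrow> real mat" where
  "mid_core N s =
     mat (N + 1) (N + 1) (\<lambda>(\<alpha>, \<beta>). poly (lagrange_basis N \<alpha>) ((real s + cheb_node N \<beta>) / 2))"

definition right_core :: "nat \<Rightarrow> nat \<Rightarrow> real mat" where
  "right_core N s = mat (N + 1) 1 (\<lambda>(\<alpha>, _). poly (lagrange_basis N \<alpha>) (real s / 2))"

text \<open>The error is a supremum in the extended reals, since it may be infinite.
  All arguments of \<open>f\<close> lie in \<open>[0, 1]\<close>.\<close>

definition interp_error :: "nat \<Rightarrow> nat \<Rightarrow> (real \<Rightarrow> real) \<Rightarrow> ereal" where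
  "interp_error m N f =
     (SUP (u, v) \<in> {0..1 - (1 / 2) ^ m} \<times> {0..1}.
        ereal \<bar>f (u + (1 / 2) ^ m * v)
          - (\<Sum>\<alpha>=0..N. f (u + (1 / 2) ^ m * cheb_node N \<alpha>) * poly (lagrange_basis N \<alpha>) v)\<bar>)"

end

theory Submission
  imports Defs
begin

text \<open>
  Interpolation in \<open>N + 1\<close> nodes reproduces every polynomial of degree at most \<open>N\<close>
  (\<open>lagrange_interpolation_exact\<close>). Each \<open>P\<^sup>\<alpha>((s + x) / 2)\<close> is such a polynomial in \<open>x\<close>, so
  multiplying the column of values \<open>P\<^sup>\<beta>(x)\<close> by the middle core for the bit \<open>s\<close> gives exactly the
  column of values \<open>P\<^sup>\<alpha>((s + x) / 2)\<close> (\<open>mid_core_mult_basis_column\<close>). Starting from the right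
  core, the product of all cores but the leftmost is therefore the column \<open>P\<^sup>\<alpha>(v)\<close> with \<open>v\<close> the
  binary fraction \<open>0.\<sigma>\<^sub>2\<dots>\<sigma>\<^sub>K\<close>; no error accumulates. Hence \<open>S(\<sigma>)\<close> is the interpolant of
  \<open>v \<mapsto> f((\<sigma>\<^sub>1 + v) / 2)\<close> (\<open>matrix_product_state_eq_interpolant\<close>) and \<open>T(\<sigma>)\<close> is the value of
  that function itself, so their difference is a single interpolation error at \<open>u = \<sigma>\<^sub>1 / 2\<close>. It
  vanishes when \<open>f\<close> is a polynomial of degree at most \<open>N\<close>.
\<close>

lemma lagrange_interpolation_exact:
  assumes "N \<ge> 1" "degree q \<le> N"
  shows "(\<Sum>\<alpha>=0..N. poly q (cheb_node N \<alpha>) * poly (lagrange_basis N \<alpha>) x) = poly q x"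
proof -
  define r where "r = (\<Sum>\<alpha>=0..N. Polynomial.smult (poly q (cheb_node N \<alpha>)) (lagrange_basis N \<alpha>))"
  have inj: "inj_on (cheb_node N) {0..N}"
    using cheb_node_inj[OF assms(1)] by (auto intro!: inj_onI)
  have "r = q"
  proof (rule poly_eqI_degree)
    fix y assume "y \<in> cheb_node N ` {0..N}"
    then obtain \<beta> where \<beta>: "\<beta> \<le> N" "y = cheb_node N \<beta>" by auto
    have "poly r y = (\<Sum>\<alpha>=0..N. if \<alpha> = \<beta> then poly q (cheb_node N \<alpha>) else 0)"
      unfolding r_def poly_sum poly_smult \<beta>(2)
      using \<beta>(1) assms(1) by (intro sum.cong) (auto simp: poly_lagrange_basis_node)
    then show "poly r y = poly q y"
      using \<beta> by simp
  next
    have "degree r \<le> N"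
      unfolding r_def using assms(1)
      by (intro degree_sum_le) (auto intro: order_trans[OF degree_smult_le] simp: degree_lagrange_basis)
    then show "card (cheb_node N ` {0..N}) > degree r"
      using card_image[OF inj] by simp
    show "card (cheb_node N ` {0..N}) > degree q"
      using card_image[OF inj] assms(2) by simp
  qed
  then have "poly q x = poly r x" by simp
  then show ?thesis
    by (simp add: r_def poly_sum)
qed

lemma lagrange_interpolation_exact_affine:
  assumes "N \<ge> 1" "degree p \<le> N"
  shows "(\<Sum>\<alpha>=0..N. poly p ((s + cheb_node N \<alpha>) / 2) * poly (lagrange_basis N \<alpha>) x)
    = poly p ((s + x) / 2)"
proof -
  have "degree (pcompose p [:s / 2, 1 / 2:]) \<le> N"
    using assms(2) by (simp add: degree_pcompose)
  from lagrange_interpolation_exact[OF assms(1) this, of x] show ?thesis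
    by (simp add: poly_pcompose add_divide_distrib)
qed

text \<open>The column vector, as a matrix, of the values at \<open>x\<close> of the Lagrange basis polynomials.\<close>

definition basis_column :: "nat \<Rightarrow> real \<Rightarrow> real mat" where
  "basis_column N x = mat (N + 1) 1 (\<lambda>(\<alpha>, _). poly (lagrange_basis N \<alpha>) x)"

lemma mid_core_mult_basis_column:
  assumes "N \<ge> 1"
  shows "mid_core N s * basis_column N x = basis_column N ((real s + x) / 2)"
proof (rule eq_matI)
  fix i j
  assume "i < dim_row (basis_column N ((real s + x) / 2))"
    "j < dim_col (basis_column N ((real s + x) / 2))"
  then have i: "i \<le> N" and j: "j = 0" by (auto simp: basis_column_def)
  have "(mid_core N s * basis_column N x) $$ (i, j)
      = (\<Sum>\<beta>=0..N. poly (lagrange_basis N i) ((real s + cheb_node N \<beta>) / 2)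
          * poly (lagrange_basis N \<beta>) x)"
    using i j by (simp add: mid_core_def basis_column_def scalar_prod_def
        atLeast0LessThan lessThan_Suc_atMost atLeast0AtMost del: sum.lessThan_Suc)
  also have "\<dots> = poly (lagrange_basis N i) ((real s + x) / 2)"
    using assms i by (intro lagrange_interpolation_exact_affine) (simp_all add: degree_lagrange_basis)
  finally show "(mid_core N s * basis_column N x) $$ (i, j)
      = basis_column N ((real s + x) / 2) $$ (i, j)"
    using i j by (simp add: basis_column_def)
qed (simp_all add: mid_core_def basis_column_def)

text \<open>The binary fraction \<open>0.\<sigma>\<^sub>m\<dots>\<sigma>\<^sub>K\<close>; it is \<open>0\<close> if \<open>m > K\<close>. Since \<open>m \<le> k\<close> in the sum,
  the natural subtraction in the exponent does not truncate.\<close>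

definition binary_fraction :: "(nat \<Rightarrow> nat) \<Rightarrow> nat \<Rightarrow> nat \<Rightarrow> real" where
  "binary_fraction \<sigma> K m = (\<Sum>k=m..K. (1 / 2) ^ (Suc k - m) * real (\<sigma> k))"

lemma binary_fraction_rec:
  assumes "m \<le> K"
  shows "binary_fraction \<sigma> K m = (real (\<sigma> m) + binary_fraction \<sigma> K (Suc m)) / 2"
proof -
  have "(\<Sum>k=Suc m..K. (1 / 2) ^ (Suc k - m) * real (\<sigma> k))
      = (\<Sum>k=Suc m..K. (1 / 2) ^ (Suc k - Suc m) * real (\<sigma> k) / 2)"
    by (intro sum.cong refl) (auto simp: Suc_diff_le)
  then show ?thesis
    using assms
    by (simp add: binary_fraction_def sum.atLeast_Suc_atMost add_divide_distrib sum_divide_distrib)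
qed

lemma binary_fraction_bounds:
  assumes "\<And>k. m \<le> k \<Longrightarrow> k \<le> K \<Longrightarrow> \<sigma> k \<le> 1" "m \<le> Suc K"
  shows "binary_fraction \<sigma> K m \<in> {0..1}"
  using assms(2,1)
proof (induction m rule: inc_induct)
  case base
  then show ?case by (simp add: binary_fraction_def)
next
  case (step m)
  then have "binary_fraction \<sigma> K (Suc m) \<in> {0..1}" "\<sigma> m \<le> 1" by auto
  with step.hyps show ?case by (simp add: binary_fraction_rec)
qed

lemma quantized_tensor_eq_binary_fraction:
  assumes "K \<ge> 1"
  shows "quantized_tensor f K \<sigma> = f ((real (\<sigma> 1) + binary_fraction \<sigma> K 2) / 2)"
proof -
  have "(\<Sum>k=1..K. (1 / 2) ^ k * real (\<sigma> k)) = binary_fraction \<sigma> K 1"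
    by (simp add: binary_fraction_def)
  then show ?thesis
    unfolding quantized_tensor_def using binary_fraction_rec[OF assms, of \<sigma>]
    by (simp only: Suc_1)
qed

lemma core_product_eq_basis_column:
  assumes "N \<ge> 1" "m \<le> K"
  shows "foldr (\<lambda>k M. mid_core N (\<sigma> k) * M) [m..<K] (right_core N (\<sigma> K))
    = basis_column N (binary_fraction \<sigma> K m)"
  using assms(2)
proof (induction m rule: inc_induct)
  case base
  show ?case by (simp add: right_core_def basis_column_def binary_fraction_def)
next
  case (step m)
  then show ?case
    using assms(1) by (simp add: upt_conv_Cons mid_core_mult_basis_column binary_fraction_rec)
qed

lemma matrix_product_state_eq_interpolant:
  assumes "N \<ge> 1" "K \<ge> 2"
  shows "matrix_product_state K (left_core f N) (mid_core N) (right_core N) \<sigma>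
    = (\<Sum>\<alpha>=0..N. f ((real (\<sigma> 1) + cheb_node N \<alpha>) / 2)
        * poly (lagrange_basis N \<alpha>) (binary_fraction \<sigma> K 2))"
  unfolding matrix_product_state_def core_product_eq_basis_column[OF assms]
  by (simp add: left_core_def basis_column_def scalar_prod_def
      atLeast0LessThan lessThan_Suc_atMost atLeast0AtMost del: sum.lessThan_Suc)

theorem proposition13:
  fixes f :: "real \<Rightarrow> real" and N K :: nat and S T :: "(nat \<Rightarrow> nat) \<Rightarrow> real"
  assumes "N \<ge> 1" and "K \<ge> 2"
    and "T = quantized_tensor f K"
    and "S = matrix_product_state K (left_core f N) (mid_core N) (right_core N)"
  shows "ereal (tensor_norm K (\<lambda>\<sigma>. S \<sigma> - T \<sigma>)) \<le> interp_error 1 N f \<and>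
    ((\<exists>p :: real poly. degree p \<le> N \<and> (\<forall>x\<in>{0..1}. f x = poly p x)) \<longrightarrow>
       (\<forall>\<sigma>\<in>bit_tuples K. S \<sigma> = T \<sigma>))"
proof (intro conjI impI ballI)
  let ?v = "\<lambda>\<sigma>. binary_fraction \<sigma> K 2"
  have S: "S \<sigma> = (\<Sum>\<alpha>=0..N. f ((real (\<sigma> 1) + cheb_node N \<alpha>) / 2)
      * poly (lagrange_basis N \<alpha>) (?v \<sigma>))" for \<sigma>
    using assms matrix_product_state_eq_interpolant by simp
  have T: "T \<sigma> = f ((real (\<sigma> 1) + ?v \<sigma>) / 2)" for \<sigma>
    using assms quantized_tensor_eq_binary_fraction by simp
  have bits: "\<sigma> k \<le> 1" if "\<sigma> \<in> bit_tuples K" "1 \<le> k" "k \<le> K" for \<sigma> k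
    using that PiE_mem[of \<sigma> "{1..K}" "\<lambda>_. {0, 1}" k] by (auto simp: bit_tuples_def)
  have v: "?v \<sigma> \<in> {0..1}" if "\<sigma> \<in> bit_tuples K" for \<sigma>
    using that assms(2) by (intro binary_fraction_bounds bits) auto
  have bit1: "real (\<sigma> 1) \<le> 1" if "\<sigma> \<in> bit_tuples K" for \<sigma>
    using bits[OF that, of 1] assms(2) by simp

  have error: "ereal \<bar>S \<sigma> - T \<sigma>\<bar> \<le> interp_error 1 N f" if "\<sigma> \<in> bit_tuples K" for \<sigma>
  proof -
    have uv: "(real (\<sigma> 1) / 2, ?v \<sigma>) \<in> {0..1 - (1 / 2) ^ 1} \<times> {0..1}"
      using v[OF that] bit1[OF that] by auto
    show ?thesis
      unfolding interp_error_def
      by (rule SUP_upper2[OF uv]) (simp add: S T add_divide_distrib abs_minus_commute)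
  qed
  have "finite (bit_tuples K)" and "bit_tuples K \<noteq> {}"
    by (auto simp: bit_tuples_def intro!: finite_PiE simp: PiE_eq_empty_iff)
  then have "tensor_norm K (\<lambda>\<sigma>. S \<sigma> - T \<sigma>) \<in> (\<lambda>\<sigma>. \<bar>S \<sigma> - T \<sigma>\<bar>) ` bit_tuples K"
    unfolding tensor_norm_def by (intro Max_in) auto
  then show "ereal (tensor_norm K (\<lambda>\<sigma>. S \<sigma> - T \<sigma>)) \<le> interp_error 1 N f"
    using error by auto

  fix \<sigma>
  assume "\<exists>p :: real poly. degree p \<le> N \<and> (\<forall>x\<in>{0..1}. f x = poly p x)"
    and \<sigma>: "\<sigma> \<in> bit_tuples K"
  then obtain p where p: "degree p \<le> N" "\<And>x. x \<in> {0..1} \<Longrightarrow> f x = poly p x" by blast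
  have f_eq: "f ((real (\<sigma> 1) + x) / 2) = poly p ((real (\<sigma> 1) + x) / 2)" if "x \<in> {0..1}" for x
    using that bit1[OF \<sigma>] by (intro p(2)) auto
  have node: "cheb_node N \<alpha> \<in> {0..1}" for \<alpha>
  proof -
    have "0 \<le> cos t + 1" for t :: real
      using cos_ge_minus_one[of t] by linarith
    then show ?thesis by (simp add: cheb_node_def)
  qed
  show "S \<sigma> = T \<sigma>"
    unfolding S T f_eq[OF node] f_eq[OF v[OF \<sigma>]]
    by (rule lagrange_interpolation_exact_affine[OF assms(1) p(1)])
qed

end
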